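(* Let $H$ be a graph with at least one edge and chromatic number $\chi(H)\neq 3$. Then $$\mathrm{ex}_r(n, H)=\left(1-\frac{1}{\chi(H)-1}+o(1)\right) n \quad\text{as } n\to\infty.$$
   Context: For a graph $H$ and a positive integer $n$, the regular Turán number $\mathrm{ex}_r(n,H)$ is the maximum integer $k$ such that there exists a $k$-regular graph on $n$ vertices that does not contain $H$ as a subgraph. Graphs are finite and simple. *)

theory Defs
  imports Complex_Main "HOL-Library.Landau_Symbols"
begin

text \<open>A finite simple graph is given by its vertex set and its set of edges, each edge
  being a two-element set of vertices.\<close>

definition simple_graph :: "'a set \<Rightarrow> 'a set set \<Rightarrow> bool" where
  "simple_graph V E \<longleftrightarrow> finite V \<and> (\<forall>e\<in>E. e \<subseteq> V \<and> card e = 2)"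

definition vdegree :: "'a set set \<Rightarrow> 'a \<Rightarrow> nat" where
  "vdegree E v = card {e \<in> E. v \<in> e}"

definition regular_graph :: "'a set \<Rightarrow> 'a set set \<Rightarrow> nat \<Rightarrow> bool" where
  "regular_graph V E k \<longleftrightarrow> simple_graph V E \<and> (\<forall>v\<in>V. vdegree E v = k)"

text \<open>Subgraphs are taken up to isomorphism and need not be induced.\<close>

definition contains_subgraph ::
    "'b set \<Rightarrow> 'b set set \<Rightarrow> 'a set \<Rightarrow> 'a set set \<Rightarrow> bool" where
  "contains_subgraph V E VH EH \<longleftrightarrow>
     (\<exists>f. inj_on f VH \<and> f ` VH \<subseteq> V \<and> (\<forall>e\<in>EH. f ` e \<in> E))"

definition proper_colouring :: "'a set \<Rightarrow> 'a set set \<Rightarrow> nat \<Rightarrow> ('a \<Rightarrow> nat) \<Rightarrow> bool" where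
  "proper_colouring V E k c \<longleftrightarrow>
     c ` V \<subseteq> {..<k} \<and> (\<forall>u v. {u, v} \<in> E \<longrightarrow> c u \<noteq> c v)"

definition chromatic_number :: "'a set \<Rightarrow> 'a set set \<Rightarrow> nat" where
  "chromatic_number V E = (LEAST k. \<exists>c. proper_colouring V E k c)"

text \<open>Every finite graph is isomorphic to one whose vertices are natural numbers. The set
  below is finite for \<open>n > 0\<close>, and it contains \<open>0\<close> if the forbidden graph has an edge;
  outside these cases the value is of no significance.\<close>

definition regular_free_degrees :: "nat \<Rightarrow> 'a set \<Rightarrow> 'a set set \<Rightarrow> nat set" where
  "regular_free_degrees n VH EH =
     {k. \<exists>(V :: nat set) E. card V = n \<and> regular_graph V E k \<and> \<not> contains_subgraph V E VH EH}"

definition ex_r :: "nat \<Rightarrow> 'a set \<Rightarrow> 'a set set \<Rightarrow> nat" where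
  "ex_r n VH EH = Max (regular_free_degrees n VH EH)"

lemma finite_regular_free_degrees:
  assumes "n > 0"
  shows "finite (regular_free_degrees n VH EH)"
proof -
  have "k \<le> 2 ^ n" if k: "k \<in> regular_free_degrees n VH EH" for k
  proof -
    from k obtain V :: "nat set" and E where
      V: "card V = n" and reg: "regular_graph V E k"
      unfolding regular_free_degrees_def by blast
    from V assms obtain v where v: "v \<in> V" by fastforce
    have fin: "finite V" and E: "E \<subseteq> Pow V"
      using reg unfolding regular_graph_def simple_graph_def by auto
    have "k = card {e \<in> E. v \<in> e}"
      using reg v unfolding regular_graph_def vdegree_def by auto
    also have "\<dots> \<le> card (Pow V)"
      using fin E by (intro card_mono) auto
    also have "\<dots> = 2 ^ n"
      using fin V by (simp add: card_Pow)
    finally show ?thesis .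
  qed
  then show ?thesis
    by (meson finite_atMost finite_subset atMost_iff subsetI)
qed

lemma zero_in_regular_free_degrees:
  assumes "EH \<noteq> {}"
  shows "0 \<in> regular_free_degrees n VH EH"
proof -
  have "regular_graph {..<n} {} 0"
    by (simp add: regular_graph_def simple_graph_def vdegree_def)
  moreover have "\<not> contains_subgraph {..<n} {} VH EH"
    using assms by (auto simp: contains_subgraph_def)
  ultimately show ?thesis
    unfolding regular_free_degrees_def by (metis (mono_tags, lifting) card_lessThan mem_Collect_eq)
qed

lemma proper_colouring_exists:
  assumes "simple_graph V E"
  shows "\<exists>k c. proper_colouring V E k c"
proof -
  from assms have "finite V" by (simp add: simple_graph_def)
  then obtain c :: "'a \<Rightarrow> nat" and k where c: "c ` V = {i. i < k}" "inj_on c V"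
    using finite_imp_inj_to_nat_seg by blast
  have "c u \<noteq> c v" if "{u, v} \<in> E" for u v
  proof -
    from that assms have "{u, v} \<subseteq> V" "card {u, v} = 2"
      by (auto simp: simple_graph_def)
    then have "u \<in> V" "v \<in> V" "u \<noteq> v" by auto
    then show ?thesis using c(2) by (auto dest: inj_onD)
  qed
  then have "proper_colouring V E k c"
    using c(1) by (auto simp: proper_colouring_def)
  then show ?thesis by blast
qed

end

theory Submission
  imports Defs "HOL-Library.FuncSet"
begin

text \<open>
  Write \<open>r = \<chi>(H) - 1\<close>. For the upper bound, regularity turns a large degree into a minimum degree
  condition, under which the Erdos--Stone theorem follows by induction on the number of parts:
  given a complete \<open>r\<close>-partite subgraph \<open>K\<close> with huge parts, double counting shows that linearly
  many vertices have many neighbours in every part, and by pigeonhole many of them have the same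
  neighbourhood in \<open>K\<close>, so they form a further part.

  For the lower bound with \<open>r \<ge> 3\<close>, write \<open>n = 2rh + c\<close> with \<open>c < 2r\<close>, and take the complete
  \<open>r\<close>-partite graph with \<open>r - 1\<close> parts of size \<open>2h\<close> and one part of size \<open>2h + c\<close>. It becomes
  regular of degree \<open>2h(r - 1)\<close> after deleting a \<open>c\<close>-regular graph on the \<open>r - 1 \<ge> 2\<close> smaller parts:
  cut each of them into two halves of size \<open>h\<close>, and place \<open>c\<close>-regular bipartite graphs cyclically
  between one half of each part and the other half of the next one.
\<close>

section \<open>Degrees as numbers of neighbours\<close>

lemma vdegree_eq_card_neighbours:
  assumes "simple_graph V E"
  shows "vdegree E v = card {u \<in> V. {v, u} \<in> E}"
proof -
  have "bij_betw (\<lambda>u. {v, u}) {u \<in> V. {v, u} \<in> E} {e \<in> E. v \<in> e}"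
    unfolding bij_betw_def
  proof
    show "inj_on (\<lambda>u. {v, u}) {u \<in> V. {v, u} \<in> E}"
      by (auto simp: inj_on_def doubleton_eq_iff)
    show "(\<lambda>u. {v, u}) ` {u \<in> V. {v, u} \<in> E} = {e \<in> E. v \<in> e}"
    proof (intro equalityI subsetI)
      fix e assume e: "e \<in> {e \<in> E. v \<in> e}"
      then have "card e = 2" "e \<subseteq> V"
        using assms by (auto simp: simple_graph_def)
      with e obtain u where "e = {v, u}"
        by (auto simp: card_2_iff)
      with e \<open>e \<subseteq> V\<close> show "e \<in> (\<lambda>u. {v, u}) ` {u \<in> V. {v, u} \<in> E}" by auto
    qed auto
  qed
  then show ?thesis
    by (simp add: vdegree_def bij_betw_same_card)
qed

lemma vdegree_le_card:
  assumes "simple_graph V E"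
  shows "vdegree E v \<le> card V"
  unfolding vdegree_eq_card_neighbours[OF assms]
  using assms by (intro card_mono) (auto simp: simple_graph_def)

section \<open>The Erdos--Stone theorem for minimum degrees\<close>

text \<open>Edges inside a part are allowed, as copies need not be induced. Disjointness of the
  parts is not demanded, because it follows from the absence of loops.\<close>

definition complete_multipartite ::
    "'a set \<Rightarrow> 'a set set \<Rightarrow> nat \<Rightarrow> nat \<Rightarrow> (nat \<Rightarrow> 'a set) \<Rightarrow> bool" where
  "complete_multipartite V E r t A \<longleftrightarrow>
     (\<forall>i<r. A i \<subseteq> V \<and> card (A i) = t) \<and>
     (\<forall>i<r. \<forall>j<r. i \<noteq> j \<longrightarrow> (\<forall>x\<in>A i. \<forall>y\<in>A j. {x, y} \<in> E))"

lemma complete_multipartite_disjoint: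
  assumes "simple_graph V E" "complete_multipartite V E r t A" "i < r" "j < r" "i \<noteq> j"
  shows "A i \<inter> A j = {}"
proof -
  have "{x, x} \<notin> E" for x
    using assms(1) by (fastforce simp: simple_graph_def)
  then show ?thesis
    using assms(2-) by (fastforce simp: complete_multipartite_def)
qed

section \<open>Adding one part to a complete multipartite subgraph\<close>

lemma sum_neighbours_swap:
  assumes "finite V" "finite K"
  shows "(\<Sum>v\<in>K. card {u \<in> V. {v, u} \<in> E}) = (\<Sum>u\<in>V. card {v \<in> K. {u, v} \<in> E})"
  using assms by (intro sum_multicount_gen) (auto simp: insert_commute)

text \<open>Bounds the contribution to the double count of a vertex with few neighbours in one part:
  the other \<open>r - 1\<close> parts are counted in full.\<close>

lemma card_neighbours_le:
  fixes A :: "nat \<Rightarrow> 'a set"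
  assumes "\<And>i. i < r \<Longrightarrow> finite (A i)" "\<And>i. i < r \<Longrightarrow> card (A i) = T"
    and "i < r" "card {v \<in> A i. P v} \<le> t"
  shows "card {v \<in> (\<Union>i<r. A i). P v} \<le> (r - 1) * T + t"
proof -
  have "{v \<in> (\<Union>i<r. A i). P v} \<subseteq> (\<Union>j\<in>{..<r} - {i}. A j) \<union> {v \<in> A i. P v}"
    by auto
  then have "card {v \<in> (\<Union>i<r. A i). P v} \<le> card ((\<Union>j\<in>{..<r} - {i}. A j) \<union> {v \<in> A i. P v})"
    using assms(1,3) by (intro card_mono) auto
  also have "\<dots> \<le> card (\<Union>j\<in>{..<r} - {i}. A j) + card {v \<in> A i. P v}"
    by (rule card_Un_le)
  also have "card (\<Union>j\<in>{..<r} - {i}. A j) \<le> (\<Sum>j\<in>{..<r} - {i}. card (A j))"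
    by (rule card_UN_le) simp
  also have "\<dots> = (r - 1) * T"
    using assms(2,3) by simp
  finally show ?thesis using assms(4) by linarith
qed

text \<open>The neighbourhood of a vertex of \<open>W\<close> in the union of the parts is one of at
  most \<open>2 ^ (r * T)\<close> sets, so more than \<open>t\<close> vertices share the same one,
  \<open>S\<close>. Since \<open>S\<close> meets every old part in at least \<open>t\<close>
  vertices, the old parts can be shrunk into \<open>S\<close> and \<open>t\<close> of these vertices
  form the new part.\<close>

lemma complete_multipartite_extend:
  fixes V :: "'a set"
  assumes sg: "simple_graph V E"
    and A: "complete_multipartite V E r T A"
    and W: "\<And>u. u \<in> W \<Longrightarrow> u \<in> V" "\<And>u i. u \<in> W \<Longrightarrow> i < r \<Longrightarrow> t \<le> card {v \<in> A i. {u, v} \<in> E}"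
    and large: "t * 2 ^ (r * T) < card W"
  shows "\<exists>B. complete_multipartite V E (Suc r) t B"
proof -
  define K where "K = (\<Union>i<r. A i)"
  have finV: "finite V" using sg by (simp add: simple_graph_def)
  have AV: "A i \<subseteq> V" "card (A i) = T" "finite (A i)" if "i < r" for i
    using A that finV by (auto simp: complete_multipartite_def intro: finite_subset)
  have finK: "finite K" using AV by (auto simp: K_def)
  have finW: "finite W" using W(1) finV by (meson finite_subset subsetI)
  have "card K \<le> (\<Sum>i<r. card (A i))"
    unfolding K_def by (rule card_UN_le) simp
  then have cK: "card K \<le> r * T" using AV by simp
  define N where "N = (\<lambda>u. {v \<in> K. {u, v} \<in> E})"
  have "N \<in> W \<rightarrow> Pow K" by (auto simp: N_def)
  from pigeonhole_card[OF this finW] finK obtain S where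
    S: "S \<in> Pow K" "card (N -` {S} \<inter> W) * card (Pow K) \<ge> card W"
    by auto
  define F where "F = N -` {S} \<inter> W"
  have "t * card (Pow K) \<le> t * 2 ^ (r * T)"
    using cK finK by (simp add: card_Pow power_increasing)
  also have "\<dots> < card F * card (Pow K)"
    using large S(2) unfolding F_def by linarith
  finally have "t < card F" by simp
  then obtain B where B: "B \<subseteq> F" "card B = t"
    by (meson less_imp_le_nat obtain_subset_with_card_n)
  from \<open>t < card F\<close> obtain u where u: "u \<in> F"
    by (metis card.empty ex_in_conv not_less_zero)
  have "\<exists>C. C \<subseteq> S \<inter> A i \<and> card C = t" if "i < r" for i
  proof -
    have "{v \<in> A i. {u, v} \<in> E} = S \<inter> A i"
      using u that by (auto simp: F_def N_def K_def)
    then have "t \<le> card (S \<inter> A i)"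
      using W(2)[of u i] u that by (simp add: F_def)
    then show ?thesis
      by (meson obtain_subset_with_card_n)
  qed
  then obtain C where C: "\<And>i. i < r \<Longrightarrow> C i \<subseteq> S \<inter> A i \<and> card (C i) = t"
    by metis
  have adj: "{b, x} \<in> E" if "b \<in> B" "x \<in> C i" "i < r" for b x i
  proof -
    have "N b = S" using B that by (auto simp: F_def)
    moreover have "x \<in> S" using C that by blast
    ultimately show ?thesis by (auto simp: N_def)
  qed
  have "complete_multipartite V E (Suc r) t (C(r := B))"
    unfolding complete_multipartite_def
  proof (intro conjI allI impI ballI)
    fix i assume "i < Suc r"
    then show "(C(r := B)) i \<subseteq> V"
      using B C[of i] AV(1)[of i] W(1) by (cases "i = r") (auto simp: F_def)
    show "card ((C(r := B)) i) = t"
      using \<open>i < Suc r\<close> B C[of i] by (cases "i = r") auto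
  next
    fix i j x y
    assume ij: "i < Suc r" "j < Suc r" "i \<noteq> j" "x \<in> (C(r := B)) i" "y \<in> (C(r := B)) j"
    consider "i = r" "j < r" | "j = r" "i < r" | "i < r" "j < r" using ij by linarith
    then show "{x, y} \<in> E"
    proof cases
      case 1 then show ?thesis using ij adj by auto
    next
      case 2 then show ?thesis using ij adj[of y x i] by (auto simp: insert_commute)
    next
      case 3
      then have "x \<in> A i" "y \<in> A j" using ij C by (auto split: if_splits)
      then show ?thesis using A 3 ij by (auto simp: complete_multipartite_def)
    qed
  qed
  then show ?thesis by blast
qed

text \<open>The degree condition is multiplied by \<open>r\<close> so that it is void for \<open>r = 0\<close>, where the
  induction starts.\<close>

theorem erdos_stone_min_degree:
  fixes e :: real
  assumes e: "e > 0"
  shows "\<exists>N. \<forall>(V :: 'a set) E. simple_graph V E \<and> N \<le> card V \<and>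
           (\<forall>v\<in>V. (real r - 1 + e) * real (card V) \<le> real r * real (vdegree E v)) \<longrightarrow>
           (\<exists>A. complete_multipartite V E (Suc r) t A)"
proof (induction r arbitrary: t)
  case 0
  have "\<exists>A. complete_multipartite V E (Suc 0) t A" if tV: "t \<le> card V" for V :: "'a set" and E
  proof -
    obtain B where "B \<subseteq> V" "card B = t"
      using obtain_subset_with_card_n[OF tV] by blast
    then have "complete_multipartite V E (Suc 0) t (\<lambda>_. B)"
      by (auto simp: complete_multipartite_def)
    then show ?thesis by blast
  qed
  then show ?case by blast
next
  case (Suc r0)
  define r where "r = Suc r0"
  \<comment> \<open>This makes \<open>T * e - t\<close> at least 1, so that in the double count
    below every vertex of \<open>V\<close> contributes a surplus of at least 1.\<close>
  obtain T :: nat where "(real t + 1) / e \<le> real T"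
    using real_arch_simple by blast
  then have T: "real t + 1 \<le> real T * e" using e by (simp add: field_simps)
  obtain N where N: "\<And>(V :: 'a set) E. simple_graph V E \<Longrightarrow> N \<le> card V \<Longrightarrow>
           (\<forall>v\<in>V. (real r0 - 1 + e) * real (card V) \<le> real r0 * real (vdegree E v)) \<Longrightarrow>
           (\<exists>A. complete_multipartite V E r T A)"
    using Suc.IH[of T] unfolding r_def by blast
  \<comment> \<open>Chosen so that \<open>card V \<le> card W * (r * T)\<close> forces
    \<open>W\<close> to be large enough for the pigeonhole step.\<close>
  define M where "M = r * T * (t * 2 ^ (r * T)) + 1"
  have "\<exists>B. complete_multipartite V E (Suc r) t B"
    if sg: "simple_graph V E" and NV: "N \<le> card V" and MV: "M \<le> card V"
      and deg: "\<And>v. v \<in> V \<Longrightarrow> (real r - 1 + e) * real (card V) \<le> real r * real (vdegree E v)"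
    for V :: "'a set" and E
  proof -
    define n where "n = real (card V)"
    have finV: "finite V" using sg by (simp add: simple_graph_def)
    \<comment> \<open>Passing from \<open>r\<close> to \<open>r0\<close> lowers the left side by
      \<open>card V\<close> and the right side only by \<open>vdegree E v\<close>, which is at most
      \<open>card V\<close>.\<close>
    have "(real r0 - 1 + e) * real (card V) \<le> real r0 * real (vdegree E v)" if "v \<in> V" for v
      using deg[OF that] vdegree_le_card[OF sg, of v] by (simp add: r_def algebra_simps)
    with N sg NV obtain A where A: "complete_multipartite V E r T A" by blast
    define K where "K = (\<Union>i<r. A i)"
    have AV: "A i \<subseteq> V" "card (A i) = T" "finite (A i)" if "i < r" for i
      using A that finV by (auto simp: complete_multipartite_def intro: finite_subset)
    have finK: "finite K" and KV: "K \<subseteq> V" using AV by (auto simp: K_def)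
    have "card K = (\<Sum>i<r. card (A i))"
      unfolding K_def using AV complete_multipartite_disjoint[OF sg A]
      by (intro card_UN_disjoint) auto
    then have cK: "card K = r * T" using AV by simp
    define W where "W = {u \<in> V. \<forall>i<r. t \<le> card {v \<in> A i. {u, v} \<in> E}}"
    have WV: "W \<subseteq> V" by (auto simp: W_def)
    have bound: "card {v \<in> K. {u, v} \<in> E} \<le> (if u \<in> W then r * T else 0) + (r0 * T + t)"
      if "u \<in> V" for u
    proof (cases "u \<in> W")
      case True
      have "card {v \<in> K. {u, v} \<in> E} \<le> card K"
        using finK by (intro card_mono) auto
      then show ?thesis using True cK by simp
    next
      case False
      with that obtain i where "i < r" "card {v \<in> A i. {u, v} \<in> E} \<le> t"
        unfolding W_def by (auto simp: not_le)
      from card_neighbours_le[of r A T i "\<lambda>v. {u, v} \<in> E" t, OF _ _ this] AV False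
      show ?thesis by (simp add: K_def r_def)
    qed
    have "(\<Sum>v\<in>K. vdegree E v) = (\<Sum>u\<in>V. card {v \<in> K. {u, v} \<in> E})"
      using sum_neighbours_swap[OF finV finK] by (simp add: vdegree_eq_card_neighbours[OF sg])
    also have "\<dots> \<le> (\<Sum>u\<in>V. (if u \<in> W then r * T else 0) + (r0 * T + t))"
      by (intro sum_mono bound)
    also have "\<dots> = card W * (r * T) + card V * (r0 * T + t)"
      using finV WV by (simp add: sum.distrib sum.If_cases Int_absorb1)
    finally have upper: "(\<Sum>v\<in>K. vdegree E v) \<le> card W * (r * T) + card V * (r0 * T + t)" .
    have "real (card K) * ((real r - 1 + e) * n) \<le> (\<Sum>v\<in>K. real r * real (vdegree E v))"
      using deg KV by (intro sum_bounded_below) (auto simp: n_def)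
    also have "\<dots> = real r * real (\<Sum>v\<in>K. vdegree E v)"
      by (simp add: sum_distrib_left)
    also have "\<dots> \<le> real r * real (card W * (r * T) + card V * (r0 * T + t))"
      using upper by (intro mult_left_mono) (auto simp only: of_nat_le_iff of_nat_0_le_iff)
    finally have "real r * (real T * ((real r - 1 + e) * n)) \<le>
        real r * (real (card W * (r * T)) + n * (real r0 * real T + real t))"
      by (simp add: cK n_def algebra_simps)
    \<comment> \<open>The factor \<open>r\<close> cancels because it is a successor.\<close>
    then have "real T * ((real r - 1 + e) * n) \<le>
        real (card W * (r * T)) + n * (real r0 * real T + real t)"
      by (simp add: r_def)
    then have "(real T * e - real t) * n \<le> real (card W * (r * T))"
      by (simp add: r_def algebra_simps)
    moreover have "1 * n \<le> (real T * e - real t) * n"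
      using T by (intro mult_right_mono) (auto simp: n_def)
    ultimately have "card V \<le> card W * (r * T)"
      unfolding n_def by linarith
    with MV have "r * T * (t * 2 ^ (r * T)) < r * T * card W"
      unfolding M_def by (simp only: mult.commute[of "card W"])
    then have "t * 2 ^ (r * T) < card W" by simp
    then show ?thesis
      by (rule complete_multipartite_extend[OF sg A, rotated 2]) (simp_all add: W_def)
  qed
  then have "\<forall>(V :: 'a set) E. simple_graph V E \<and> max N M \<le> card V \<and>
           (\<forall>v\<in>V. (real r - 1 + e) * real (card V) \<le> real r * real (vdegree E v)) \<longrightarrow>
           (\<exists>A. complete_multipartite V E (Suc r) t A)"
    by simp
  then show ?case unfolding r_def by blast
qed

text \<open>Each colour class goes into its own part. Every part has room for all of
  \<open>VH\<close>, so the sizes of the classes do not matter.\<close>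

lemma contains_subgraph_of_complete_multipartite:
  assumes G: "simple_graph V E" and A: "complete_multipartite V E r (card VH) A"
    and H: "simple_graph VH EH" and c: "proper_colouring VH EH r c"
  shows "contains_subgraph V E VH EH"
proof -
  have "\<exists>g. inj_on g VH \<and> g ` VH \<subseteq> A i" if "i < r" for i
  proof -
    have "card (A i) = card VH" "finite (A i)"
      using A G that by (auto simp: complete_multipartite_def simple_graph_def intro: finite_subset)
    moreover have "finite VH" using H by (simp add: simple_graph_def)
    ultimately show ?thesis by (metis card_le_inj order_refl)
  qed
  then obtain g where g: "\<And>i. i < r \<Longrightarrow> inj_on (g i) VH \<and> g i ` VH \<subseteq> A i" by metis
  define f where "f = (\<lambda>x. g (c x) x)"
  have cr: "c x < r" if "x \<in> VH" for x
    using c that by (auto simp: proper_colouring_def)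
  have fA: "f x \<in> A (c x)" if "x \<in> VH" for x
    using g[OF cr[OF that]] that by (auto simp: f_def)
  have "inj_on f VH"
  proof (rule inj_onI)
    fix x y assume xy: "x \<in> VH" "y \<in> VH" "f x = f y"
    then have "A (c x) \<inter> A (c y) \<noteq> {}" using fA by fastforce
    then have "c x = c y"
      using complete_multipartite_disjoint[OF G A cr cr] xy by blast
    with xy g[OF cr[OF xy(1)]] show "x = y"
      by (auto simp: f_def dest: inj_onD)
  qed
  moreover have "f ` VH \<subseteq> V"
    using fA cr A by (fastforce simp: complete_multipartite_def)
  moreover have "f ` e \<in> E" if "e \<in> EH" for e
  proof -
    obtain x y where e: "e = {x, y}" "x \<in> VH" "y \<in> VH"
      using H \<open>e \<in> EH\<close> by (fastforce simp: simple_graph_def card_2_iff)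
    then have "c x \<noteq> c y" using c \<open>e \<in> EH\<close> by (auto simp: proper_colouring_def)
    then have "{f x, f y} \<in> E"
      using A fA[OF e(2)] fA[OF e(3)] cr[OF e(2)] cr[OF e(3)]
      unfolding complete_multipartite_def by blast
    then show ?thesis using e(1) by simp
  qed
  ultimately show ?thesis unfolding contains_subgraph_def by blast
qed

section \<open>The upper bound for the regular Turan number\<close>

lemma ex_r_upper:
  fixes VH :: "'a set"
  assumes H: "simple_graph VH EH" "EH \<noteq> {}" and c: "proper_colouring VH EH (Suc r) c"
    and r: "r > 0" and e: "e > 0"
  shows "\<exists>N. \<forall>n\<ge>N. n > 0 \<longrightarrow> real (ex_r n VH EH) \<le> (1 - 1 / real r + e) * real n"
proof -
  \<comment> \<open>The degree condition of \<open>erdos_stone_min_degree\<close> carries a factor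
    \<open>r\<close>, so the excess \<open>e\<close> becomes \<open>e * r\<close>.\<close>
  have "e * real r > 0" using e r by simp
  from erdos_stone_min_degree[OF this, of r "card VH", where 'a = nat] obtain N where
    N: "\<And>(V :: nat set) E. simple_graph V E \<Longrightarrow> N \<le> card V \<Longrightarrow>
           (\<forall>v\<in>V. (real r - 1 + e * real r) * real (card V) \<le> real r * real (vdegree E v)) \<Longrightarrow>
           (\<exists>A. complete_multipartite V E (Suc r) (card VH) A)"
    by blast
  have "real (ex_r n VH EH) \<le> (1 - 1 / real r + e) * real n" if n: "n \<ge> N" "n > 0" for n
  proof (rule ccontr)
    define k where "k = ex_r n VH EH"
    assume "\<not> real (ex_r n VH EH) \<le> (1 - 1 / real r + e) * real n"
    then have k: "(1 - 1 / real r + e) * real n \<le> real k" by (simp add: k_def)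
    have "real r * ((1 - 1 / real r + e) * real n) \<le> real r * real k"
      by (rule mult_left_mono[OF k]) simp
    also have "real r * ((1 - 1 / real r + e) * real n) = (real r - 1 + e * real r) * real n"
      using r by (simp add: field_simps)
    finally have deg: "(real r - 1 + e * real r) * real n \<le> real r * real k" .
    have "k \<in> regular_free_degrees n VH EH"
      unfolding k_def ex_r_def
      using finite_regular_free_degrees[OF n(2)] zero_in_regular_free_degrees[OF H(2)]
      by (intro Max_in) blast+
    then obtain V :: "nat set" and E where V: "card V = n" "regular_graph V E k"
      "\<not> contains_subgraph V E VH EH"
      by (auto simp: regular_free_degrees_def)
    then have "\<exists>A. complete_multipartite V E (Suc r) (card VH) A"
      using n deg by (intro N) (auto simp: regular_graph_def)
    then show False
      using V contains_subgraph_of_complete_multipartite[OF _ _ H(1) c]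
      by (auto simp: regular_graph_def)
  qed
  then show ?thesis by blast
qed

section \<open>Regular multipartite graphs\<close>

text \<open>A copy of the forbidden graph would pull the colouring \<open>p\<close> back to a proper
  colouring with \<open>r\<close> colours. Any vertex type may be used, since a bijection carries
  the graph over to \<open>{0..<n}\<close>.\<close>

lemma regular_free_degreesI:
  fixes W :: "'b set" and VH :: "'a set"
  assumes W: "finite W" "card W = n"
    and sym: "\<And>u v. adj u v \<Longrightarrow> adj v u"
    and deg: "\<And>v. v \<in> W \<Longrightarrow> card {u \<in> W. adj v u} = k"
    and col: "\<And>v. v \<in> W \<Longrightarrow> p v < r" "\<And>u v. u \<in> W \<Longrightarrow> v \<in> W \<Longrightarrow> adj u v \<Longrightarrow> p u \<noteq> p v"
    and H: "simple_graph VH EH" "\<nexists>c. proper_colouring VH EH r c"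
  shows "k \<in> regular_free_degrees n VH EH"
proof -
  obtain g :: "'b \<Rightarrow> nat" where g: "bij_betw g W {0..<n}"
    using W ex_bij_betw_finite_nat by blast
  then have inj: "g u = g v \<longleftrightarrow> u = v" if "u \<in> W" "v \<in> W" for u v
    using that by (auto simp: bij_betw_def inj_on_def)
  have im: "g ` W = {0..<n}" using g by (simp add: bij_betw_def)
  define E where "E = {{g u, g v} | u v. u \<in> W \<and> v \<in> W \<and> adj u v}"
  have E_iff: "{g u, g v} \<in> E \<longleftrightarrow> adj u v" if "u \<in> W" "v \<in> W" for u v
    using that sym inj by (auto simp: E_def doubleton_eq_iff)
  have sg: "simple_graph {0..<n} E"
    unfolding simple_graph_def
  proof (intro conjI ballI)
    fix e assume "e \<in> E"
    then obtain u v where e: "e = {g u, g v}" "u \<in> W" "v \<in> W" "adj u v"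
      by (auto simp: E_def)
    \<comment> \<open>Properness of \<open>p\<close> also excludes loops.\<close>
    then have "g u \<noteq> g v" using col(2) inj by metis
    then show "card e = 2" using e by simp
    show "e \<subseteq> {0..<n}" using e im by auto
  qed simp
  have "vdegree E (g v) = k" if "v \<in> W" for v
  proof -
    have "{w \<in> {0..<n}. {g v, w} \<in> E} = g ` {u \<in> W. adj v u}"
      using im E_iff[OF that] by force
    moreover have "inj_on g {u \<in> W. adj v u}"
      using inj by (auto simp: inj_on_def)
    ultimately show ?thesis
      using deg[OF that] by (simp add: vdegree_eq_card_neighbours[OF sg] card_image)
  qed
  then have "regular_graph {0..<n} E k"
    using sg unfolding regular_graph_def im[symmetric] by blast
  moreover have "\<not> contains_subgraph {0..<n} E VH EH"
  proof
    assume "contains_subgraph {0..<n} E VH EH"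
    then obtain f where f: "f ` VH \<subseteq> {0..<n}" "\<And>e. e \<in> EH \<Longrightarrow> f ` e \<in> E"
      by (auto simp: contains_subgraph_def)
    define c where "c = (\<lambda>x. p (inv_into W g (f x)))"
    have inv: "inv_into W g (f x) \<in> W" "g (inv_into W g (f x)) = f x" if "x \<in> VH" for x
      using f(1) im that by (auto intro!: inv_into_into f_inv_into_f)
    have "proper_colouring VH EH r c"
      unfolding proper_colouring_def
    proof (intro conjI allI impI)
      show "c ` VH \<subseteq> {..<r}" using inv col by (auto simp: c_def)
      fix u v assume uv: "{u, v} \<in> EH"
      then have "u \<in> VH" "v \<in> VH" using H by (auto simp: simple_graph_def)
      with f(2)[OF uv] inv[of u] inv[of v]
      have "adj (inv_into W g (f u)) (inv_into W g (f v))"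
        using E_iff by force
      then show "c u \<noteq> c v" unfolding c_def
        using \<open>u \<in> VH\<close> \<open>v \<in> VH\<close> inv col(2) by blast
    qed
    with H(2) show False by blast
  qed
  ultimately show ?thesis
    unfolding regular_free_degrees_def by force
qed

text \<open>Translation by \<open>x\<close> permutes the residues modulo \<open>h\<close>, and
  exactly \<open>c\<close> residues lie below \<open>c\<close>.\<close>

lemma card_sum_mod_less:
  assumes "c \<le> h"
  shows "card {y. y < h \<and> (x + y) mod h < c} = c"
proof (cases "h = 0")
  case False
  have inj: "inj_on (\<lambda>y. (x + y) mod h) {..<h}"
  proof (rule linorder_inj_onI)
    fix y z assume yz: "y < z" "y \<in> {..<h}" "z \<in> {..<h}"
    then have "\<not> h dvd (x + z) - (x + y)" by (intro nat_dvd_not_less) auto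
    then show "(x + y) mod h \<noteq> (x + z) mod h"
      using yz mod_eq_dvd_iff_nat[of "x + y" "x + z" h] by simp
  qed auto
  then have "(\<lambda>y. (x + y) mod h) ` {..<h} = {..<h}"
    using False by (intro endo_inj_surj) auto
  then have "(\<lambda>y. (x + y) mod h) ` {y. y < h \<and> (x + y) mod h < c} = {..<c}"
    using assms by (auto simp: image_iff set_eq_iff) (metis lessThan_iff order_less_le_trans)
  moreover have "inj_on (\<lambda>y. (x + y) mod h) {y. y < h \<and> (x + y) mod h < c}"
    by (rule inj_on_subset[OF inj]) auto
  ultimately show ?thesis
    using card_image by force
qed (use assms in auto)

text \<open>A vertex \<open>Inl (i, b, x)\<close> lies in half \<open>b\<close> of the small part \<open>i < s\<close>, and \<open>Inr y\<close> in the
  large part. The condition \<open>(x + y) mod h < c\<close> is symmetric in \<open>x\<close> and \<open>y\<close> and makes each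
  bipartite graph between two halves \<open>c\<close>-regular.\<close>

definition removed :: "nat \<Rightarrow> nat \<Rightarrow> nat \<Rightarrow> nat \<times> bool \<times> nat \<Rightarrow> nat \<times> bool \<times> nat \<Rightarrow> bool" where
  "removed s h c = (\<lambda>(i, b, x) (j, b', y).
     b \<noteq> b' \<and> (x + y) mod h < c \<and> (if b then i = Suc j mod s else j = Suc i mod s))"

fun turan_adj ::
    "nat \<Rightarrow> nat \<Rightarrow> nat \<Rightarrow> (nat \<times> bool \<times> nat) + nat \<Rightarrow> (nat \<times> bool \<times> nat) + nat \<Rightarrow> bool" where
  "turan_adj s h c (Inl u) (Inl v) \<longleftrightarrow> fst u \<noteq> fst v \<and> \<not> removed s h c u v"
| "turan_adj s h c (Inl u) (Inr y) \<longleftrightarrow> True"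
| "turan_adj s h c (Inr x) (Inl v) \<longleftrightarrow> True"
| "turan_adj s h c (Inr x) (Inr y) \<longleftrightarrow> False"

lemma turan_adj_sym: "turan_adj s h c u v \<Longrightarrow> turan_adj s h c v u"
  by (cases u; cases v) (auto simp: removed_def add.commute split: if_splits)

text \<open>Removed edges join different parts. This is where two small parts are essential: for
  \<open>s = 1\<close> the next part would be the part itself.\<close>

lemma Suc_mod_neq:
  assumes "i < s" "s \<ge> 2"
  shows "Suc i mod s \<noteq> i"
  using assms by (cases "Suc i = s") auto

lemma Suc_mod_predecessor:
  assumes "i < s" "s \<ge> 2"
  shows "\<exists>j<s. \<forall>j'<s. i = Suc j' mod s \<longleftrightarrow> j' = j"
proof (cases i)
  case 0
  have "i = Suc j' mod s \<longleftrightarrow> j' = s - 1" if "j' < s" for j'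
    using 0 that assms by (cases "Suc j' = s") auto
  then show ?thesis using assms by (intro exI[of _ "s - 1"]) auto
next
  case (Suc j)
  have "i = Suc j' mod s \<longleftrightarrow> j' = j" if "j' < s" for j'
    using Suc that assms by (cases "Suc j' = s") auto
  then show ?thesis using assms Suc by (intro exI[of _ j]) auto
qed

text \<open>Half \<open>False\<close> of each part is paired with half \<open>True\<close> of the
  cyclically next one, so every half has exactly one partner. The halves keep both directions apart
  even for \<open>s = 2\<close>.\<close>

lemma card_removed:
  assumes "i < s" "s \<ge> 2" "c \<le> h"
  shows "card {v \<in> {..<s} \<times> UNIV \<times> {..<h}. removed s h c (i, b, x) v} = c"
proof -
  have "\<exists>j<s. \<forall>j'<s. (if b then i = Suc j' mod s else j' = Suc i mod s) \<longleftrightarrow> j' = j"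
  proof (cases b)
    case True
    then show ?thesis using Suc_mod_predecessor[OF assms(1,2)] by simp
  next
    case False
    then show ?thesis using assms by (intro exI[of _ "Suc i mod s"]) auto
  qed
  then obtain j where j: "j < s"
    "\<And>j'. j' < s \<Longrightarrow> (if b then i = Suc j' mod s else j' = Suc i mod s) \<longleftrightarrow> j' = j"
    by blast
  have "{v \<in> {..<s} \<times> UNIV \<times> {..<h}. removed s h c (i, b, x) v} =
      {j} \<times> {\<not> b} \<times> {y. y < h \<and> (x + y) mod h < c}"
    using j by (auto simp: removed_def)
  then show ?thesis
    using card_sum_mod_less[OF assms(3), of x] by (simp add: card_cartesian_product)
qed

text \<open>A vertex of the large part sees all \<open>2 * h * s\<close> vertices of the small
  parts. A vertex of a small part misses the \<open>2 * h\<close> vertices of its own part and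
  \<open>c\<close> removed neighbours, which balances the \<open>2 * h + c\<close> vertices of the
  large part.\<close>

lemma multipartite_degree_in_regular_free_degrees:
  assumes s: "s \<ge> 2" and c: "c \<le> h"
    and H: "simple_graph VH EH" "\<nexists>c. proper_colouring VH EH (Suc s) c"
  shows "2 * h * s \<in> regular_free_degrees (2 * h * s + 2 * h + c) VH EH"
proof -
  define S where "S = {..<s} \<times> (UNIV :: bool set) \<times> {..<h}"
  define L where "L = {..<2 * h + c}"
  define W where "W = Inl ` S \<union> Inr ` L"
  have fin: "finite S" "finite L" by (auto simp: S_def L_def)
  have cS: "card S = 2 * h * s" by (simp add: S_def card_cartesian_product)
  have cL: "card L = 2 * h + c" by (simp add: L_def)
  have card_split: "card {w \<in> W. P w} = card {u \<in> S. P (Inl u)} + card {y \<in> L. P (Inr y)}" for P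
  proof -
    have "{w \<in> W. P w} = {u \<in> S. P (Inl u)} <+> {y \<in> L. P (Inr y)}"
      by (auto simp: W_def)
    then show ?thesis using fin by (simp add: card_Plus)
  qed
  show ?thesis
  proof (rule regular_free_degreesI[where W = W and adj = "turan_adj s h c"
        and p = "case_sum fst (\<lambda>_. s)" and r = "Suc s", OF _ _ turan_adj_sym _ _ _ H])
    show "finite W" using fin by (simp add: W_def)
    show "card W = 2 * h * s + 2 * h + c"
      using card_split[of "\<lambda>_. True"] cS cL by simp
    show "case_sum fst (\<lambda>_. s) v < Suc s" if "v \<in> W" for v
      using that by (auto simp: W_def S_def)
    show "case_sum fst (\<lambda>_. s) u \<noteq> case_sum fst (\<lambda>_. s) v"
      if "u \<in> W" "v \<in> W" "turan_adj s h c u v" for u v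
      using that by (auto simp: W_def S_def)
    show "card {u \<in> W. turan_adj s h c v u} = 2 * h * s" if "v \<in> W" for v
    proof (cases v)
      case (Inr y)
      then show ?thesis using card_split[of "turan_adj s h c v"] cS by simp
    next
      case (Inl w)
      then obtain i b x where w: "w = (i, b, x)" "i < s"
        using \<open>v \<in> W\<close> by (auto simp: W_def S_def)
      define P where "P = {i} \<times> (UNIV :: bool set) \<times> {..<h}"
      define R where "R = {u \<in> S. removed s h c w u}"
      have cP: "card P = 2 * h" by (simp add: P_def card_cartesian_product)
      have cR: "card R = c"
        unfolding R_def S_def w using card_removed w(2) s c by blast
      have "P \<inter> R = {}"
        using Suc_mod_neq[OF w(2) s] w by (auto simp: P_def R_def removed_def)
      then have cPR: "card (P \<union> R) = 2 * h + c"
        using cP cR fin by (subst card_Un_disjoint) (auto simp: P_def R_def)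
      have "{u \<in> S. turan_adj s h c v (Inl u)} = S - (P \<union> R)"
        using w Inl by (auto simp: S_def P_def R_def)
      moreover have "P \<union> R \<subseteq> S"
        using w by (auto simp: S_def P_def R_def)
      ultimately have "card {u \<in> S. turan_adj s h c v (Inl u)} + (2 * h + c) = card S"
        using cPR fin by (metis card_Diff_subset card_mono finite_subset le_add_diff_inverse2)
      then show ?thesis
        using card_split[of "turan_adj s h c v"] cS cL Inl by simp
    qed
  qed
qed

section \<open>The lower bound for large \<open>n\<close>\<close>

lemma ex_r_lower:
  assumes r: "r \<ge> 3" and n: "(2 * r) ^ 2 \<le> n"
    and H: "simple_graph VH EH" "\<nexists>c. proper_colouring VH EH r c"
  shows "(1 - 1 / real r) * real n - 2 * real r \<le> real (ex_r n VH EH)"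
proof -
  define h c where "h = n div (2 * r)" and "c = n mod (2 * r)"
  have "c < 2 * r" using r by (simp add: c_def)
  \<comment> \<open>The quadratic bound on \<open>n\<close> makes the halves large enough to carry
    \<open>c\<close>-regular bipartite graphs.\<close>
  moreover have "2 * r \<le> h"
    using n r by (simp add: h_def less_eq_div_iff_mult_less_eq power2_eq_square)
  ultimately have ch: "c \<le> h" by linarith
  have nhc: "n = 2 * h * r + c"
    using div_mult_mod_eq[of n "2 * r"] by (simp add: h_def c_def mult_ac)
  then have "n = 2 * h * (r - 1) + 2 * h + c" using r by (cases r) auto
  with multipartite_degree_in_regular_free_degrees[of "r - 1" c h VH EH] r ch H
  have mem: "2 * h * (r - 1) \<in> regular_free_degrees n VH EH" by simp
  have "n > 0" using n r by (auto intro: gr0I)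
  then have "2 * h * (r - 1) \<le> ex_r n VH EH"
    unfolding ex_r_def by (intro Max_ge finite_regular_free_degrees mem)
  then have "real (2 * h * (r - 1)) \<le> real (ex_r n VH EH)" by (simp only: of_nat_le_iff)
  moreover have "(1 - 1 / real r) * real n - 2 * real r \<le> real (2 * h * (r - 1))"
  proof -
    have "(1 - 1 / real r) * real n = (1 - 1 / real r) * (2 * real h * real r) + (1 - 1 / real r) * real c"
      unfolding nhc by (simp add: algebra_simps)
    also have "(1 - 1 / real r) * (2 * real h * real r) = real (2 * h * (r - 1))"
      using r by (simp add: field_simps of_nat_diff)
    also have "(1 - 1 / real r) * real c \<le> 1 * real c"
      by (intro mult_right_mono) auto
    finally show ?thesis using \<open>c < 2 * r\<close> by simp
  qed
  ultimately show ?thesis by linarith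
qed

section \<open>The asymptotics\<close>

lemma proper_colouring_chromatic_number:
  assumes "simple_graph V E"
  shows "\<exists>c. proper_colouring V E (chromatic_number V E) c"
  unfolding chromatic_number_def using proper_colouring_exists[OF assms] by (rule LeastI_ex)

lemma not_proper_colouring_less_chromatic_number:
  assumes "k < chromatic_number V E"
  shows "\<nexists>c. proper_colouring V E k c"
  using assms unfolding chromatic_number_def by (rule not_less_Least)

lemma chromatic_number_ge_2:
  assumes "simple_graph V E" "E \<noteq> {}"
  shows "chromatic_number V E \<ge> 2"
proof -
  obtain u v where uv: "{u, v} \<in> E" "u \<in> V" "v \<in> V"
    using assms by (fastforce simp: simple_graph_def card_2_iff)
  obtain c where "proper_colouring V E (chromatic_number V E) c"
    using proper_colouring_chromatic_number[OF assms(1)] by blast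
  then have "c u \<noteq> c v" "c u < chromatic_number V E" "c v < chromatic_number V E"
    using uv by (auto simp: proper_colouring_def)
  then show ?thesis by linarith
qed

theorem theorem12:
  fixes VH :: "'a set" and EH :: "'a set set"
  assumes "simple_graph VH EH"
    and "EH \<noteq> {}"
    and "chromatic_number VH EH \<noteq> 3"
  shows "\<exists>\<epsilon> :: nat \<Rightarrow> real. \<epsilon> \<in> o(\<lambda>_. 1) \<and>
           (\<forall>n>0. real (ex_r n VH EH) =
              (1 - 1 / (real (chromatic_number VH EH) - 1) + \<epsilon> n) * real n)"
proof -
  define r where "r = chromatic_number VH EH - 1"
  have chi: "chromatic_number VH EH = Suc r" and r: "r > 0" "r \<noteq> 2"
    using chromatic_number_ge_2[OF assms(1,2)] assms(3) by (auto simp: r_def)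
  obtain col where col: "proper_colouring VH EH (Suc r) col"
    using proper_colouring_chromatic_number[OF assms(1)] chi by auto
  have ncol: "\<nexists>c. proper_colouring VH EH r c"
    by (rule not_proper_colouring_less_chromatic_number) (simp add: chi)
  \<comment> \<open>For \<open>n > 0\<close> this is the only possible error term; its value at 0 is
    irrelevant to the claim.\<close>
  define \<delta> where "\<delta> = (\<lambda>n. real (ex_r n VH EH) / real n - (1 - 1 / real r))"
  have lower: "- (2 * real r / real n) \<le> \<delta> n" if n: "n \<ge> (2 * r) ^ 2" for n
  proof -
    have n0: "n > 0" using n r by (auto intro: gr0I)
    have "(1 - 1 / real r) * real n - 2 * real r \<le> real (ex_r n VH EH)"
    \<comment> \<open>For \<open>r = 1\<close>, the bipartite case, the main term vanishes and the
      bound is trivial. Otherwise \<open>r \<noteq> 2\<close> gives \<open>r \<ge> 3\<close>, as the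
      construction requires.\<close>
    proof (cases "r = 1")
      case False
      then show ?thesis using ex_r_lower[OF _ n assms(1) ncol] r by simp
    qed simp
    then have "((1 - 1 / real r) * real n - 2 * real r) / real n \<le> real (ex_r n VH EH) / real n"
      by (rule divide_right_mono) simp
    then show ?thesis using n0 by (simp add: \<delta>_def diff_divide_distrib)
  qed
  have "\<delta> \<longlonglongrightarrow> 0"
  proof (rule LIMSEQ_I)
    fix e :: real assume e: "e > 0"
    then have "e / 2 > 0" by simp
    \<comment> \<open>The non-strict upper bound is taken with \<open>e / 2\<close> to leave room
      for strictness.\<close>
    from ex_r_upper[OF assms(1,2) col r(1) this] obtain N where
      N: "\<And>n. n \<ge> N \<Longrightarrow> n > 0 \<Longrightarrow> real (ex_r n VH EH) \<le> (1 - 1 / real r + e / 2) * real n"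
      by blast
    obtain M :: nat where M: "2 * real r / e < real M"
      using reals_Archimedean2 by blast
    have "norm (\<delta> n - 0) < e" if n: "n \<ge> max N (max M ((2 * r) ^ 2))" for n
    proof -
      have n0: "n > 0" using n r by (auto intro: gr0I)
      have "\<delta> n \<le> e / 2"
        using N[of n] n n0 by (simp add: \<delta>_def field_simps)
      moreover have "2 * real r / real n < e"
      proof -
        have "2 * real r / e < real n" using M n by simp
        then show ?thesis using e n0 by (simp add: field_simps)
      qed
      ultimately show ?thesis using lower[of n] n e by auto
    qed
    then show "\<exists>no. \<forall>n\<ge>no. norm (\<delta> n - 0) < e" by blast
  qed
  then have "\<delta> \<in> o(\<lambda>_. 1)" by (intro smalloI_tendsto) auto
  moreover have "\<forall>n>0. real (ex_r n VH EH) =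
              (1 - 1 / (real (chromatic_number VH EH) - 1) + \<delta> n) * real n"
    by (simp add: \<delta>_def chi)
  ultimately show ?thesis by blast
qed

end
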